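(* Every submodule $\mathcal{S}$ of the Hardy module $H^2(\mathbb{D})$ is maximal.
   Context: $H^2(\mathbb{D})$ is the Hardy space on the unit disc and $M_z$ is the operator of multiplication by the coordinate function. A submodule of $H^2(\mathbb{D})$ is a closed subspace $\mathcal{S}$ with $M_z\mathcal{S}\subseteq\mathcal{S}$; put $R_{\mathcal{S}}:=M_z|_{\mathcal{S}}$, a contraction on $\mathcal{S}$. For a contraction $T$ on a Hilbert space and $n\in\mathbb{N}=\{1,2,\dots\}$ let $\Delta_T^n:=\dim\overline{\mathrm{ran}}(I-T^nT^{*n})$ (the superscript on $\Delta$ is an index, not a power) and $\Delta_T:=\Delta_T^1$. The submodule $\mathcal{S}$ is called maximal if the contraction $T=R_{\mathcal{S}}$ is maximal, i.e. $\Delta_T^n=n\,\Delta_T$ for all $n\in\mathbb{N}$. *)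

theory Defs
  imports
    "HOL-Complex_Analysis.Complex_Analysis"
    "HOL-Library.Function_Algebras"
    "HOL-Library.Extended_Nat"
begin

section \<open>Complex Hilbert spaces on a carrier set\<close>

text \<open>
  A Hilbert space is given by a carrier \<open>H\<close> inside an ambient complex vector space and an inner
  product \<open>ip\<close>, linear in the first argument, that is only meaningful on \<open>H\<close>. In this way a closed
  subspace is again a Hilbert space, with the same \<open>ip\<close> and a smaller carrier.
\<close>

locale complex_inner_product_space = vector_space scale
  for scale :: "complex \<Rightarrow> 'a::ab_group_add \<Rightarrow> 'a" +
  fixes H :: "'a set" and ip :: "'a \<Rightarrow> 'a \<Rightarrow> complex"
  assumes subspace_H: "subspace H"
    and ip_commute: "x \<in> H \<Longrightarrow> y \<in> H \<Longrightarrow> ip x y = cnj (ip y x)"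
    and ip_add_left: "x \<in> H \<Longrightarrow> y \<in> H \<Longrightarrow> z \<in> H \<Longrightarrow> ip (x + y) z = ip x z + ip y z"
    and ip_scale_left: "x \<in> H \<Longrightarrow> y \<in> H \<Longrightarrow> ip (scale c x) y = c * ip x y"
    and ip_pos: "x \<in> H \<Longrightarrow> x \<noteq> 0 \<Longrightarrow> 0 < Re (ip x x)"
begin

definition hnorm :: "'a \<Rightarrow> real" where
  "hnorm x = sqrt (Re (ip x x))"

text \<open>The value outside \<open>H\<close> is irrelevant; it is fixed because \<^locale>\<open>Metric_space\<close> requires
  symmetry and nonnegativity of the distance everywhere.\<close>

definition hdist :: "'a \<Rightarrow> 'a \<Rightarrow> real" where
  "hdist x y = (if x \<in> H \<and> y \<in> H then hnorm (x - y) else 0)"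

lemma H_closed:
  "0 \<in> H" "x \<in> H \<Longrightarrow> y \<in> H \<Longrightarrow> x + y \<in> H" "x \<in> H \<Longrightarrow> scale c x \<in> H"
  "x \<in> H \<Longrightarrow> y \<in> H \<Longrightarrow> x - y \<in> H" "x \<in> H \<Longrightarrow> - x \<in> H"
  using subspace_0[OF subspace_H] subspace_add[OF subspace_H] subspace_scale[OF subspace_H]
    subspace_diff[OF subspace_H] subspace_neg[OF subspace_H] by simp_all

lemma ip_zero_left: "x \<in> H \<Longrightarrow> ip 0 x = 0"
  using ip_scale_left[of 0 x 0] H_closed(1) by simp

lemma ip_zero_right: "x \<in> H \<Longrightarrow> ip x 0 = 0"
  using ip_commute[of x 0] H_closed(1) by (simp add: ip_zero_left)

lemma ip_add_right: "x \<in> H \<Longrightarrow> y \<in> H \<Longrightarrow> z \<in> H \<Longrightarrow> ip x (y + z) = ip x y + ip x z"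
  using ip_commute[of x "y + z"] ip_commute[of x y] ip_commute[of x z]
  by (simp add: H_closed ip_add_left)

lemma ip_scale_right: "x \<in> H \<Longrightarrow> y \<in> H \<Longrightarrow> ip x (scale c y) = cnj c * ip x y"
  using ip_commute[of x "scale c y"] ip_commute[of x y]
  by (simp add: H_closed ip_scale_left)

lemma ip_minus_left: "x \<in> H \<Longrightarrow> y \<in> H \<Longrightarrow> ip (- x) y = - ip x y"
  using ip_scale_left[of x y "-1"] by simp

lemma ip_minus_right: "x \<in> H \<Longrightarrow> y \<in> H \<Longrightarrow> ip x (- y) = - ip x y"
  using ip_scale_right[of x y "-1"] by simp

lemma ip_nonneg: "x \<in> H \<Longrightarrow> 0 \<le> Re (ip x x)"
  using ip_pos[of x] ip_zero_left[of 0] H_closed(1) by (cases "x = 0") auto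

lemma ip_self: "x \<in> H \<Longrightarrow> ip x x = complex_of_real ((hnorm x)\<^sup>2)"
  using ip_commute[of x x] ip_nonneg[of x] by (simp add: hnorm_def complex_eq_iff)

lemma hnorm_nonneg: "x \<in> H \<Longrightarrow> 0 \<le> hnorm x"
  by (simp add: hnorm_def ip_nonneg)

lemma hnorm_eq_0: "x \<in> H \<Longrightarrow> hnorm x = 0 \<longleftrightarrow> x = 0"
  using ip_pos[of x] ip_zero_left[of 0] H_closed(1) by (cases "x = 0") (auto simp: hnorm_def)

lemma hnorm_minus: "x \<in> H \<Longrightarrow> hnorm (- x) = hnorm x"
  by (simp add: hnorm_def ip_minus_left ip_minus_right H_closed)

lemma Cauchy_Schwarz:
  assumes "x \<in> H" "y \<in> H"
  shows "cmod (ip x y) \<le> hnorm x * hnorm y"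
proof (cases "y = 0")
  case True
  then show ?thesis using assms by (simp add: ip_zero_right hnorm_def ip_zero_left)
next
  case False
  define b where "b = (hnorm y)\<^sup>2"
  define a where "a = ip x y"
  have b: "b > 0" using False assms hnorm_eq_0[of y] by (simp add: b_def)
  define c where "c = - a / b"
  have yx: "ip y x = cnj a" using ip_commute[of y x] assms by (simp add: a_def)
  have "0 \<le> Re (ip (x + scale c y) (x + scale c y))"
    using assms by (intro ip_nonneg) (simp add: H_closed)
  also have "ip (x + scale c y) (x + scale c y)
      = (hnorm x)\<^sup>2 + cnj c * a + c * cnj a + c * cnj c * b"
    using assms by (simp add: ip_add_left ip_add_right ip_scale_left ip_scale_right H_closed
        yx ip_self[of x] ip_self[of y] b_def a_def[symmetric] algebra_simps)
  also have "\<dots> = complex_of_real ((hnorm x)\<^sup>2 - (cmod a)\<^sup>2 / b)"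
    using b complex_norm_square[of a] by (simp add: c_def field_simps power2_eq_square)
  finally have "(cmod a)\<^sup>2 / b \<le> (hnorm x)\<^sup>2" by simp
  then have "(cmod a)\<^sup>2 \<le> (hnorm x * hnorm y)\<^sup>2"
    using b by (simp add: field_simps b_def)
  then show ?thesis
    using assms by (simp add: a_def hnorm_nonneg power2_le_iff_abs_le)
qed

lemma hnorm_triangle:
  assumes "x \<in> H" "y \<in> H"
  shows "hnorm (x + y) \<le> hnorm x + hnorm y"
proof -
  have "(hnorm (x + y))\<^sup>2 = Re (ip (x + y) (x + y))"
    using assms by (simp add: ip_self H_closed)
  also have "\<dots> = (hnorm x)\<^sup>2 + (hnorm y)\<^sup>2 + 2 * Re (ip x y)"
    using assms ip_commute[of y x]
    by (simp add: ip_add_left ip_add_right H_closed ip_self[of x] ip_self[of y])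
  also have "Re (ip x y) \<le> hnorm x * hnorm y"
    using Cauchy_Schwarz[OF assms] complex_Re_le_cmod order_trans by blast
  finally have "(hnorm (x + y))\<^sup>2 \<le> (hnorm x + hnorm y)\<^sup>2"
    by (simp add: power2_sum)
  then show ?thesis
    by (rule power2_le_imp_le) (simp add: assms hnorm_nonneg)
qed

sublocale Metric_space H hdist
proof
  show "0 \<le> hdist x y" for x y by (simp add: hdist_def hnorm_nonneg H_closed)
  show "hdist x y = hdist y x" for x y
    using hnorm_minus[of "x - y"] by (simp add: hdist_def H_closed)
  show "hdist x y = 0 \<longleftrightarrow> x = y" if "x \<in> H" "y \<in> H" for x y
    using that by (simp add: hdist_def hnorm_eq_0 H_closed)
  show "hdist x z \<le> hdist x y + hdist y z" if "x \<in> H" "y \<in> H" "z \<in> H" for x y z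
    using that hnorm_triangle[of "x - y" "y - z"] by (simp add: hdist_def H_closed)
qed

end

locale complex_hilbert_space = complex_inner_product_space +
  assumes complete_H: mcomplete
begin

text \<open>Contractions of \<open>H\<close> into itself; a map is only considered on \<open>H\<close>.\<close>

definition contraction :: "('a \<Rightarrow> 'a) \<Rightarrow> bool" where
  "contraction T \<longleftrightarrow>
     T ` H \<subseteq> H \<and>
     (\<forall>x\<in>H. \<forall>y\<in>H. T (x + y) = T x + T y) \<and>
     (\<forall>c. \<forall>x\<in>H. T (scale c x) = scale c (T x)) \<and>
     (\<forall>x\<in>H. hnorm (T x) \<le> hnorm x)"

text \<open>For a bounded operator \<open>T\<close> on \<open>H\<close> and \<open>y \<in> H\<close> the described element exists by the Riesz
  representation theorem, and it is unique because \<open>ip\<close> is definite on \<open>H\<close>.\<close>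

definition adj :: "('a \<Rightarrow> 'a) \<Rightarrow> 'a \<Rightarrow> 'a" where
  "adj T y = (THE z. z \<in> H \<and> (\<forall>x\<in>H. ip (T x) y = ip x z))"

text \<open>Dimension of a subspace over the complex numbers; all infinite dimensions are \<open>\<infinity>\<close>.
  For closed subspaces, finite linear and finite Hilbert space dimension agree, and so does
  being infinite-dimensional in either sense.\<close>

definition edim :: "'a set \<Rightarrow> enat" where
  "edim V = (if \<exists>B. finite B \<and> V \<subseteq> span B then enat (dim V) else \<infinity>)"

definition defect_index :: "('a \<Rightarrow> 'a) \<Rightarrow> nat \<Rightarrow> enat" where
  "defect_index T n =
     edim (mtopology closure_of ((\<lambda>x. x - (T ^^ n) ((adj T ^^ n) x)) ` H))"

definition maximal_contraction :: "('a \<Rightarrow> 'a) \<Rightarrow> bool" where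
  "maximal_contraction T \<longleftrightarrow>
     contraction T \<and> (\<forall>n\<ge>1. defect_index T n = enat n * defect_index T 1)"

lemma closed_subspace_hilbert_space:
  assumes sub: "subspace S" and closed: "closedin mtopology S"
  shows "complex_hilbert_space scale S ip"
proof -
  have SH: "S \<subseteq> H" using closed metric_closedin_iff_sequentially_closed by blast
  interpret S: complex_inner_product_space scale S ip
  proof
    show "subspace S" by (fact sub)
    show "ip x y = cnj (ip y x)" if "x \<in> S" "y \<in> S" for x y
      using that SH by (intro ip_commute) auto
  qed (use SH in \<open>simp_all add: subset_iff ip_add_left ip_scale_left ip_pos\<close>)
  have dist_eq: "S.hdist x y = hdist x y" if "x \<in> S" "y \<in> S" for x y
    using that SH by (auto simp: hdist_def S.hdist_def)
  have "\<exists>x. limitin S.mtopology \<sigma> x sequentially" if "S.MCauchy \<sigma>" for \<sigma>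
  proof -
    have ran: "\<sigma> n \<in> S" for n using that by (auto simp: S.MCauchy_def)
    have "MCauchy \<sigma>"
      using that SH ran unfolding MCauchy_def S.MCauchy_def by (auto simp: dist_eq)
    then obtain x where x: "limitin mtopology \<sigma> x sequentially"
      using complete_H unfolding mcomplete_def by blast
    then have "x \<in> S"
      using closed ran metric_closedin_iff_sequentially_closed by blast
    then have "limitin S.mtopology \<sigma> x sequentially"
      using x ran by (simp add: limit_metric_sequentially S.limit_metric_sequentially dist_eq) blast
    then show ?thesis ..
  qed
  then have "S.mcomplete" by (simp add: S.mcomplete_def)
  then show ?thesis by unfold_locales
qed

end


section \<open>The Hardy space of the unit disc\<close>

definition fscale :: "complex \<Rightarrow> (complex \<Rightarrow> complex) \<Rightarrow> complex \<Rightarrow> complex" where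
  "fscale c f = (\<lambda>z. c * f z)"

abbreviation taylor_coeff :: "(complex \<Rightarrow> complex) \<Rightarrow> nat \<Rightarrow> complex" where
  "taylor_coeff f n \<equiv> fps_nth (fps_expansion f 0) n"

text \<open>Functions on the disc are extended by \<open>0\<close>, so that equality of functions is equality on
  the disc.\<close>

definition hardy2 :: "(complex \<Rightarrow> complex) set" where
  "hardy2 = {f. f holomorphic_on ball 0 1 \<and> (\<forall>z. z \<notin> ball 0 1 \<longrightarrow> f z = 0) \<and>
                summable (\<lambda>n. (cmod (taylor_coeff f n))\<^sup>2)}"

definition hardy_ip :: "(complex \<Rightarrow> complex) \<Rightarrow> (complex \<Rightarrow> complex) \<Rightarrow> complex" where
  "hardy_ip f g = (\<Sum>n. taylor_coeff f n * cnj (taylor_coeff g n))"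

lemma fscale_apply [simp]: "fscale c f z = c * f z"
  by (simp add: fscale_def)

lemma hardy2_has_fps_expansion: "f \<in> hardy2 \<Longrightarrow> f has_fps_expansion fps_expansion f 0"
  by (rule has_fps_expansion_fps_expansion[of "ball 0 1"]) (auto simp: hardy2_def)

lemma fps_expansion_add:
  assumes "f \<in> hardy2" "g \<in> hardy2"
  shows "fps_expansion (f + g) 0 = fps_expansion f 0 + fps_expansion g 0"
  using has_fps_expansion_add[OF assms[THEN hardy2_has_fps_expansion]]
  by (intro fps_expansion_eqI) (simp add: plus_fun_def)

lemma fps_expansion_fscale:
  assumes "f \<in> hardy2"
  shows "fps_expansion (fscale c f) 0 = fps_const c * fps_expansion f 0"
  using has_fps_expansion_cmult_left[OF assms[THEN hardy2_has_fps_expansion]]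
  by (intro fps_expansion_eqI) (simp add: fscale_def)

lemma fps_expansion_zero: "fps_expansion (0 :: complex \<Rightarrow> complex) 0 = 0"
  by (intro fps_expansion_eqI) (simp add: zero_fun_def)

lemma cmod_sum_square_le: "(cmod (a + b))\<^sup>2 \<le> 2 * (cmod a)\<^sup>2 + 2 * (cmod b)\<^sup>2"
proof -
  have "(cmod (a + b))\<^sup>2 \<le> (cmod a + cmod b)\<^sup>2"
    by (simp add: norm_triangle_ineq power_mono)
  also have "\<dots> \<le> 2 * (cmod a)\<^sup>2 + 2 * (cmod b)\<^sup>2"
    using zero_le_power2[of "cmod a - cmod b"] by (simp add: power2_sum power2_diff)
  finally show ?thesis .
qed

lemma square_summable_add:
  assumes "summable (\<lambda>n. (cmod (a n))\<^sup>2)" "summable (\<lambda>n. (cmod (b n))\<^sup>2)"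
  shows "summable (\<lambda>n. (cmod (a n + b n))\<^sup>2)"
  by (rule summable_comparison_test'[of "\<lambda>n. 2 * (cmod (a n))\<^sup>2 + 2 * (cmod (b n))\<^sup>2"])
     (use assms cmod_sum_square_le in \<open>auto intro!: summable_add summable_mult\<close>)

lemma square_summable_mult:
  assumes "summable (\<lambda>n. (cmod (a n))\<^sup>2)" "summable (\<lambda>n. (cmod (b n))\<^sup>2)"
  shows "summable (\<lambda>n. a n * cnj (b n))"
proof (rule summable_comparison_test'[of "\<lambda>n. (cmod (a n))\<^sup>2 + (cmod (b n))\<^sup>2"])
  show "summable (\<lambda>n. (cmod (a n))\<^sup>2 + (cmod (b n))\<^sup>2)" using assms by (rule summable_add)
  have "x * y \<le> x\<^sup>2 + y\<^sup>2" if "0 \<le> x" "0 \<le> y" for x y :: real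
    using zero_le_power2[of "x - y"] mult_nonneg_nonneg[OF that]
    unfolding power2_diff by linarith
  then show "norm (a n * cnj (b n)) \<le> (cmod (a n))\<^sup>2 + (cmod (b n))\<^sup>2" for n
    by (simp add: norm_mult)
qed

lemma hardy2_D:
  assumes "f \<in> hardy2"
  shows "f holomorphic_on ball 0 1" "z \<notin> ball 0 1 \<Longrightarrow> f z = 0"
    "summable (\<lambda>n. (cmod (taylor_coeff f n))\<^sup>2)"
  using assms by (auto simp: hardy2_def)

lemma hardy2_add: "f \<in> hardy2 \<Longrightarrow> g \<in> hardy2 \<Longrightarrow> f + g \<in> hardy2"
  using square_summable_add[of "taylor_coeff f" "taylor_coeff g"]
  unfolding hardy2_def mem_Collect_eq
  by (subst fps_expansion_add)
     (auto simp: hardy2_def plus_fun_def intro!: holomorphic_intros)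

lemma hardy2_fscale: "f \<in> hardy2 \<Longrightarrow> fscale c f \<in> hardy2"
  unfolding hardy2_def mem_Collect_eq
  by (subst fps_expansion_fscale)
     (auto simp: hardy2_def fscale_def norm_mult power_mult_distrib
           intro!: holomorphic_intros summable_mult)

lemma hardy2_zero: "0 \<in> hardy2"
  by (simp add: hardy2_def fps_expansion_zero) (simp add: zero_fun_def)

lemma hardy_ip_summable:
  "f \<in> hardy2 \<Longrightarrow> g \<in> hardy2 \<Longrightarrow> summable (\<lambda>n. taylor_coeff f n * cnj (taylor_coeff g n))"
  by (intro square_summable_mult hardy2_D)

lemma hardy_ip_self:
  assumes "f \<in> hardy2"
  shows "hardy_ip f f = complex_of_real (\<Sum>n. (cmod (taylor_coeff f n))\<^sup>2)"
  using suminf_of_real[OF hardy2_D(3)[OF assms], where 'a = complex]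
  by (simp add: hardy_ip_def flip: complex_norm_square)

lemma hardy2_eqI:
  assumes "f \<in> hardy2" "g \<in> hardy2" "\<And>n. taylor_coeff f n = taylor_coeff g n"
  shows "f = g"
proof
  fix z
  show "f z = g z"
  proof (cases "z \<in> ball 0 1")
    case True
    have "fps_expansion f 0 = fps_expansion g 0" using assms(3) by (simp add: fps_eq_iff)
    then show ?thesis
      using True has_fps_expansion_imp_eval_fps_eq[OF hardy2_has_fps_expansion[OF assms(1)], of z 1]
        has_fps_expansion_imp_eval_fps_eq[OF hardy2_has_fps_expansion[OF assms(2)], of z 1]
        hardy2_D(1) assms(1,2) by simp
  next
    case False
    then show ?thesis using hardy2_D(2)[OF assms(1)] hardy2_D(2)[OF assms(2)] by metis
  qed
qed

lemma square_summable_imp_hardy2: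
  assumes "summable (\<lambda>n. (cmod (b n))\<^sup>2)"
  obtains f where "f \<in> hardy2" "\<And>n. taylor_coeff f n = b n"
proof -
  define f where "f = (\<lambda>z. if z \<in> ball 0 1 then eval_fps (Abs_fps b) z else 0)"
  have "(\<lambda>n. (cmod (b n))\<^sup>2) \<longlonglongrightarrow> 0" by (rule summable_LIMSEQ_zero[OF assms])
  then have "b \<longlonglongrightarrow> 0"
    by (auto dest: tendsto_real_sqrt intro: tendsto_norm_zero_cancel)
  then have "Bseq b" by (rule convergent_imp_Bseq[OF convergentI])
  then obtain K where K: "\<And>n. cmod (b n) \<le> K" by (auto simp: Bseq_def)
  have "conv_radius b \<ge> 1"
  proof (rule conv_radius_geI_ex)
    fix r :: real assume r: "0 < r" "ereal r < 1"
    have "summable (\<lambda>n. b n * complex_of_real r ^ n)"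
    proof (rule summable_comparison_test'[of "\<lambda>n. K * r ^ n"])
      show "summable (\<lambda>n. K * r ^ n)" using r by (intro summable_mult summable_geometric) auto
      show "norm (b n * complex_of_real r ^ n) \<le> K * r ^ n" for n
        using r K[of n] by (simp add: norm_mult norm_power mult_right_mono)
    qed
    then show "\<exists>z. norm z = r \<and> summable (\<lambda>n. b n * z ^ n)"
      using r by (intro exI[of _ "complex_of_real r"]) auto
  qed
  then have rad: "fps_conv_radius (Abs_fps b) \<ge> 1" by (simp add: fps_conv_radius_def)
  then have pos: "fps_conv_radius (Abs_fps b) > 0" by (rule less_le_trans[rotated]) simp
  have hol: "f holomorphic_on ball 0 1"
  proof (rule holomorphic_transform)
    show "eval_fps (Abs_fps b) holomorphic_on ball 0 1"
    proof (rule holomorphic_on_eval_fps, rule subsetI)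
      fix z :: complex assume "z \<in> ball 0 1"
      then have "ereal (norm z) < 1" by simp
      then show "z \<in> eball 0 (fps_conv_radius (Abs_fps b))"
        using less_le_trans[OF _ rad] by (simp add: in_eball_iff)
    qed
  qed (simp add: f_def)
  have "eventually (\<lambda>z::complex. z \<in> ball 0 1) (nhds 0)"
    by (rule eventually_nhds_in_open) auto
  then have "eventually (\<lambda>z. eval_fps (Abs_fps b) z = f z) (nhds 0)"
    by (rule eventually_mono) (simp add: f_def)
  then have "f has_fps_expansion Abs_fps b"
    using pos by (simp add: has_fps_expansion_def)
  then have coeff: "taylor_coeff f n = b n" for n by (simp add: fps_expansion_eqI)
  moreover have "f \<in> hardy2"
    using hol assms by (auto simp: hardy2_def coeff) (auto simp: f_def)
  ultimately show thesis using that by blast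
qed

global_interpretation hardy: complex_inner_product_space fscale hardy2 hardy_ip
proof
  show "fscale a (x + y) = fscale a x + fscale a y" for a x y
    by (auto simp: fun_eq_iff algebra_simps)
  show "fscale (a + b) x = fscale a x + fscale b x" for a b x
    by (auto simp: fun_eq_iff algebra_simps)
  show "fscale a (fscale b x) = fscale (a * b) x" for a b x
    by (auto simp: fun_eq_iff algebra_simps)
  show "fscale 1 x = x" for x
    by (auto simp: fun_eq_iff)
  then interpret vector_space fscale
    by unfold_locales (auto simp: fun_eq_iff algebra_simps)
  show "subspace hardy2"
    by (intro subspaceI hardy2_zero hardy2_add hardy2_fscale)
  show "hardy_ip x y = cnj (hardy_ip y x)" if "x \<in> hardy2" "y \<in> hardy2" for x y
    using bounded_linear.suminf[OF bounded_linear_cnj hardy_ip_summable[OF that(2,1)]]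
    by (simp add: hardy_ip_def mult.commute)
  show "hardy_ip (x + y) z = hardy_ip x z + hardy_ip y z"
    if "x \<in> hardy2" "y \<in> hardy2" "z \<in> hardy2" for x y z
    using that suminf_add[OF hardy_ip_summable[OF that(1,3)] hardy_ip_summable[OF that(2,3)]]
    by (simp add: hardy_ip_def fps_expansion_add algebra_simps)
  show "hardy_ip (fscale c x) y = c * hardy_ip x y" if "x \<in> hardy2" "y \<in> hardy2" for x y c
    using that suminf_mult[OF hardy_ip_summable[OF that], of c]
    by (simp add: hardy_ip_def fps_expansion_fscale algebra_simps)
  show "0 < Re (hardy_ip x x)" if "x \<in> hardy2" "x \<noteq> 0" for x
  proof -
    obtain n where "taylor_coeff x n \<noteq> 0"
      using \<open>x \<noteq> 0\<close> hardy2_eqI[OF \<open>x \<in> hardy2\<close> hardy2_zero]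
      by (metis fps_expansion_zero fps_zero_nth)
    then show ?thesis
      using suminf_pos2[OF hardy2_D(3)[OF \<open>x \<in> hardy2\<close>], of n] \<open>x \<in> hardy2\<close>
      by (simp add: hardy_ip_self)
  qed
qed

lemma hardy_hnorm_square:
  "f \<in> hardy2 \<Longrightarrow> (hardy.hnorm f)\<^sup>2 = (\<Sum>n. (cmod (taylor_coeff f n))\<^sup>2)"
  by (simp add: hardy.hnorm_def hardy_ip_self suminf_nonneg hardy2_D)

lemma taylor_coeff_diff:
  assumes "f \<in> hardy2" "g \<in> hardy2"
  shows "taylor_coeff (f - g) n = taylor_coeff f n - taylor_coeff g n"
  using fps_expansion_add[of "f - g" g] assms hardy.H_closed(4)[OF assms] by simp

lemma hardy_partial_sum_le:
  assumes "f \<in> hardy2" "g \<in> hardy2"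
  shows "(\<Sum>n<N. (cmod (taylor_coeff f n - taylor_coeff g n))\<^sup>2) \<le> (hardy.hdist f g)\<^sup>2"
  using assms sum_le_suminf[OF hardy2_D(3)[OF hardy.H_closed(4)[OF assms]], of "{..<N}"]
  by (simp add: hardy.hdist_def hardy_hnorm_square hardy.H_closed taylor_coeff_diff)

global_interpretation hardy: complex_hilbert_space fscale hardy2 hardy_ip
proof
  have "\<exists>f. limitin hardy.mtopology \<sigma> f sequentially" if cau: "hardy.MCauchy \<sigma>" for \<sigma>
  proof -
    have ran: "\<sigma> k \<in> hardy2" for k using cau by (auto simp: hardy.MCauchy_def)
    let ?c = "\<lambda>k. taylor_coeff (\<sigma> k)"
    define b where "b n = lim (\<lambda>k. ?c k n)" for n
    have dist: "\<exists>K. \<forall>k\<ge>K. \<forall>l\<ge>K. hardy.hdist (\<sigma> k) (\<sigma> l) < e" if "e > 0" for e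
      using cau that by (auto simp: hardy.MCauchy_def)
    have "Cauchy (\<lambda>k. ?c k n)" for n
    proof (rule metric_CauchyI)
      fix e :: real assume "e > 0"
      then obtain K where K: "\<And>k l. k \<ge> K \<Longrightarrow> l \<ge> K \<Longrightarrow> hardy.hdist (\<sigma> k) (\<sigma> l) < e"
        using dist by blast
      have "dist (?c k n) (?c l n) < e" if "k \<ge> K" "l \<ge> K" for k l
      proof -
        have "0 \<le> (\<Sum>i<n. (cmod (?c k i - ?c l i))\<^sup>2)" by (rule sum_nonneg) simp
        then have "(cmod (?c k n - ?c l n))\<^sup>2 \<le> (hardy.hdist (\<sigma> k) (\<sigma> l))\<^sup>2"
          using hardy_partial_sum_le[OF ran[of k] ran[of l], of "Suc n"]
          unfolding sum.lessThan_Suc by linarith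
        then have "cmod (?c k n - ?c l n) \<le> hardy.hdist (\<sigma> k) (\<sigma> l)"
          by (rule power2_le_imp_le) simp
        with K[OF that] show ?thesis by (simp add: dist_norm)
      qed
      then show "\<exists>M. \<forall>m\<ge>M. \<forall>k\<ge>M. dist (?c m n) (?c k n) < e" by blast
    qed
    then have "convergent (\<lambda>k. ?c k n)" for n by (rule Cauchy_convergent)
    then have b: "(\<lambda>k. ?c k n) \<longlonglongrightarrow> b n" for n
      unfolding b_def convergent_LIMSEQ_iff .
    have tail: "\<exists>K. \<forall>k\<ge>K. \<forall>N. (\<Sum>n<N. (cmod (?c k n - b n))\<^sup>2) \<le> e\<^sup>2" if "e > 0" for e
    proof -
      obtain K where K: "\<And>k l. k \<ge> K \<Longrightarrow> l \<ge> K \<Longrightarrow> hardy.hdist (\<sigma> k) (\<sigma> l) < e"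
        using dist[OF \<open>e > 0\<close>] by blast
      have "(\<Sum>n<N. (cmod (?c k n - b n))\<^sup>2) \<le> e\<^sup>2" if "k \<ge> K" for k N
      proof (rule tendsto_upperbound)
        show "(\<lambda>l. \<Sum>n<N. (cmod (?c k n - ?c l n))\<^sup>2) \<longlonglongrightarrow> (\<Sum>n<N. (cmod (?c k n - b n))\<^sup>2)"
          by (intro tendsto_intros b)
        show "eventually (\<lambda>l. (\<Sum>n<N. (cmod (?c k n - ?c l n))\<^sup>2) \<le> e\<^sup>2) sequentially"
          using eventually_ge_at_top[of K]
        proof eventually_elim
          case (elim l)
          have "(hardy.hdist (\<sigma> k) (\<sigma> l))\<^sup>2 \<le> e\<^sup>2"
            using K[OF that elim] by (intro power_mono) auto
          then show ?case using hardy_partial_sum_le[OF ran ran] order_trans by blast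
        qed
      qed simp
      then show ?thesis by blast
    qed
    obtain K where K: "\<And>k N. k \<ge> K \<Longrightarrow> (\<Sum>n<N. (cmod (?c k n - b n))\<^sup>2) \<le> 1\<^sup>2"
      using tail[OF zero_less_one] by blast
    have "summable (\<lambda>n. (cmod (?c K n - b n))\<^sup>2)"
      using K[of K] by (intro summableI_nonneg_bounded[where x = 1]) auto
    then have "summable (\<lambda>n. (cmod (b n - ?c K n))\<^sup>2)" by (simp add: norm_minus_commute)
    from square_summable_add[OF this hardy2_D(3)[OF ran[of K]]]
    have "summable (\<lambda>n. (cmod (b n))\<^sup>2)" by simp
    then obtain f where f: "f \<in> hardy2" "\<And>n. taylor_coeff f n = b n"
      using square_summable_imp_hardy2[of b] by metis
    have "\<exists>K. \<forall>k\<ge>K. hardy.hdist (\<sigma> k) f < e" if "e > 0" for e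
    proof -
      obtain K where K: "\<And>k N. k \<ge> K \<Longrightarrow> (\<Sum>n<N. (cmod (?c k n - b n))\<^sup>2) \<le> (e / 2)\<^sup>2"
        using tail[OF half_gt_zero[OF \<open>e > 0\<close>]] by blast
      have "hardy.hdist (\<sigma> k) f < e" if "k \<ge> K" for k
      proof -
        have mem: "\<sigma> k - f \<in> hardy2" using ran f by (intro hardy.H_closed)
        have "(hardy.hdist (\<sigma> k) f)\<^sup>2 = (\<Sum>n. (cmod (?c k n - b n))\<^sup>2)"
          using ran f mem by (simp add: hardy.hdist_def hardy_hnorm_square taylor_coeff_diff)
        also have "\<dots> \<le> (e / 2)\<^sup>2"
          using hardy2_D(3)[OF mem] K[OF that]
          by (intro suminf_le_const) (simp_all add: taylor_coeff_diff ran f)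
        finally have "hardy.hdist (\<sigma> k) f \<le> e / 2"
          using \<open>e > 0\<close> by (auto intro: power2_le_imp_le)
        then show ?thesis using \<open>e > 0\<close> by simp
      qed
      then show ?thesis by blast
    qed
    then have "limitin hardy.mtopology \<sigma> f sequentially"
      using f ran by (auto simp: hardy.limit_metric_sequentially)
    then show ?thesis by blast
  qed
  then show "hardy.mcomplete" by (simp add: hardy.mcomplete_def)
qed


section \<open>Submodules\<close>

definition Mz :: "(complex \<Rightarrow> complex) \<Rightarrow> complex \<Rightarrow> complex" where
  "Mz f = (\<lambda>z. z * f z)"

definition hardy_submodule :: "(complex \<Rightarrow> complex) set \<Rightarrow> bool" where
  "hardy_submodule S \<longleftrightarrow>
     hardy.subspace S \<and> closedin hardy.mtopology S \<and> Mz ` S \<subseteq> S"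

lemma hardy_submodule_hilbert_space:
  "hardy_submodule S \<Longrightarrow> complex_hilbert_space fscale S hardy_ip"
  by (simp add: hardy_submodule_def hardy.closed_subspace_hilbert_space)

text \<open>The operator \<open>R_S\<close> on the Hilbert space \<open>S\<close> is \<^term>\<open>restrict Mz S\<close>; the defect indices
  below are therefore formed with the adjoint taken in \<open>S\<close>, not in the Hardy space.\<close>

definition maximal_submodule :: "(complex \<Rightarrow> complex) set \<Rightarrow> bool" where
  "maximal_submodule S \<longleftrightarrow>
     complex_hilbert_space.maximal_contraction fscale S hardy_ip (restrict Mz S)"

end

theory Submission
  imports Defs
begin

text \<open>
  Only the fact that \<open>M\<^sub>z\<close> restricts to an isometry \<open>T\<close> of the Hilbert space \<open>S\<close> matters.
  Since \<open>T\<^sup>* T = I\<close>, the range of \<open>I - T\<^sup>n T\<^sup>*\<^sup>n\<close> is exactly the kernel \<open>W\<^sub>n\<close> of \<open>T\<^sup>*\<^sup>n\<close>, which is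
  closed. The operator \<open>T\<^sup>*\<close> maps \<open>W\<^bsub>n+1\<^esub>\<close> onto \<open>W\<^sub>n\<close> with kernel \<open>W\<^sub>1\<close>, so rank-nullity gives
  \<open>dim W\<^bsub>n+1\<^esub> = dim W\<^sub>n + dim W\<^sub>1\<close>.
\<close>

section \<open>The Riesz representation theorem\<close>

context complex_inner_product_space
begin

lemma ip_diff_right: "x \<in> H \<Longrightarrow> y \<in> H \<Longrightarrow> z \<in> H \<Longrightarrow> ip x (y - z) = ip x y - ip x z"
  using ip_add_right[of x "y - z" z] by (simp add: H_closed)

lemma hnorm_add_square:
  "x \<in> H \<Longrightarrow> y \<in> H \<Longrightarrow> (hnorm (x + y))\<^sup>2 = (hnorm x)\<^sup>2 + (hnorm y)\<^sup>2 + 2 * Re (ip x y)"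
  using ip_commute[of y x] ip_nonneg[of "x + y"]
  by (simp add: hnorm_def ip_nonneg H_closed ip_add_left ip_add_right algebra_simps)

lemma hnorm_scale: "x \<in> H \<Longrightarrow> hnorm (scale c x) = cmod c * hnorm x"
proof -
  assume x: "x \<in> H"
  have "ip (scale c x) (scale c x) = c * cnj c * ip x x"
    using x by (simp add: ip_scale_left ip_scale_right H_closed)
  also have "\<dots> = complex_of_real ((cmod c)\<^sup>2 * (hnorm x)\<^sup>2)"
    using x by (simp add: ip_self complex_norm_square del: of_real_power)
  finally have "hnorm (scale c x) = sqrt ((cmod c)\<^sup>2 * (hnorm x)\<^sup>2)"
    by (simp add: hnorm_def)
  then show ?thesis
    using x by (simp add: real_sqrt_mult hnorm_nonneg)
qed

text \<open>Test with \<open>x = y - z\<close> and use definiteness. This identifies vectors known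
  only through their inner products, such as values of an adjoint.\<close>

lemma eq_if_ip_eq:
  assumes "y \<in> H" "z \<in> H" "\<And>x. x \<in> H \<Longrightarrow> ip x y = ip x z"
  shows "y = z"
proof -
  have "ip (y - z) (y - z) = 0"
    using assms by (simp add: ip_diff_right H_closed)
  then show ?thesis
    using assms ip_pos[of "y - z"] by (auto simp: H_closed)
qed

end

context complex_hilbert_space
begin

text \<open>The representing vector is the minimizer of \<open>J z = \<parallel>z\<parallel>\<^sup>2 - 2 Re (\<phi> z)\<close>; the parallelogram law
  makes minimizing sequences Cauchy.\<close>

theorem Riesz_representation:
  assumes add: "\<And>x y. x \<in> H \<Longrightarrow> y \<in> H \<Longrightarrow> \<phi> (x + y) = \<phi> x + \<phi> y"
    and scale: "\<And>c x. x \<in> H \<Longrightarrow> \<phi> (scale c x) = c * \<phi> x"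
    and bound: "\<And>x. x \<in> H \<Longrightarrow> cmod (\<phi> x) \<le> C * hnorm x"
  obtains z where "z \<in> H" "\<And>x. x \<in> H \<Longrightarrow> \<phi> x = ip x z"
proof -
  define J where "J x = (hnorm x)\<^sup>2 - 2 * Re (\<phi> x)" for x
  \<comment> \<open>Completing the square bounds \<open>J x\<close> below by
    \<open>(hnorm x - C)^2 - C^2\<close>, so the infimum \<open>d\<close> is meaningful.\<close>
  have lower: "- C\<^sup>2 \<le> J x" if "x \<in> H" for x
  proof -
    have "Re (\<phi> x) \<le> C * hnorm x"
      using bound[OF that] complex_Re_le_cmod[of "\<phi> x"] by linarith
    moreover have "0 \<le> (hnorm x)\<^sup>2 - 2 * (C * hnorm x) + C\<^sup>2"
      using zero_le_power2[of "hnorm x - C"] by (simp add: power2_diff mult_ac)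
    ultimately show ?thesis unfolding J_def by linarith
  qed
  define d where "d = Inf (J ` H)"
  have bdd: "bdd_below (J ` H)" using lower by (auto intro!: bdd_belowI)
  have ne: "J ` H \<noteq> {}" using H_closed(1) by blast
  have d_le: "d \<le> J x" if "x \<in> H" for x
    unfolding d_def using that by (intro cInf_lower bdd) auto
  have "\<exists>x\<in>H. J x < d + inverse (real (Suc k))" for k
    using cInf_less_iff[OF ne bdd, of "d + inverse (real (Suc k))"] by (auto simp: d_def)
  then obtain s where s: "\<And>k. s k \<in> H" "\<And>k. J (s k) < d + inverse (real (Suc k))"
    by metis
  have J_lim: "(\<lambda>k. J (s k)) \<longlonglongrightarrow> d"
  proof (rule tendsto_sandwich[OF _ _ tendsto_const])
    show "(\<lambda>k. d + inverse (real (Suc k))) \<longlonglongrightarrow> d"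
      using tendsto_add[OF tendsto_const LIMSEQ_inverse_real_of_nat, of d] by simp
    show "\<forall>\<^sub>F k in sequentially. J (s k) \<le> d + inverse (real (Suc k))"
      using s(2) by (intro always_eventually) (auto intro: less_imp_le)
  qed (use d_le s in auto)
  \<comment> \<open>\<open>J\<close> is at least \<open>d\<close> at the midpoint of
    \<open>x\<close> and \<open>y\<close>; by the parallelogram law the excesses of
    \<open>J x\<close> and \<open>J y\<close> over \<open>d\<close> then control the
    distance.\<close>
  have par: "(hnorm (x - y))\<^sup>2 \<le> 2 * (J x - d) + 2 * (J y - d)" if "x \<in> H" "y \<in> H" for x y
  proof -
    have "d \<le> J (scale (1/2) (x + y))" using that by (intro d_le) (simp add: H_closed)
    also have "\<dots> = (hnorm (x + y))\<^sup>2 / 4 - Re (\<phi> x) - Re (\<phi> y)"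
      using that by (simp add: J_def hnorm_scale scale add H_closed power_divide add_divide_distrib)
    finally have "4 * d \<le> (hnorm (x + y))\<^sup>2 - 4 * Re (\<phi> x) - 4 * Re (\<phi> y)" by simp
    moreover have "(hnorm (x - y))\<^sup>2 + (hnorm (x + y))\<^sup>2 = 2 * (hnorm x)\<^sup>2 + 2 * (hnorm y)\<^sup>2"
      using that hnorm_add_square[of x y] hnorm_add_square[of x "- y"]
      by (simp add: H_closed hnorm_minus ip_minus_right)
    ultimately show ?thesis by (simp add: J_def)
  qed
  have "MCauchy s"
    unfolding MCauchy_def
  proof (intro conjI allI impI)
    fix e :: real assume e: "e > 0"
    \<comment> \<open>With an excess below \<open>e^2 / 4\<close> at both indices, the bound in
      \<open>par\<close> stays below \<open>e^2\<close>.\<close>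
    then have "\<forall>\<^sub>F k in sequentially. J (s k) < d + e\<^sup>2 / 4"
      by (intro order_tendstoD(2)[OF J_lim]) simp
    then obtain N where N: "\<And>k. k \<ge> N \<Longrightarrow> J (s k) < d + e\<^sup>2 / 4"
      by (auto simp: eventually_sequentially)
    have "hdist (s m) (s n) < e" if "N \<le> m" "N \<le> n" for m n
    proof -
      have "(hnorm (s m - s n))\<^sup>2 \<le> 2 * (J (s m) - d) + 2 * (J (s n) - d)"
        by (intro par s)
      also have "\<dots> < e\<^sup>2"
        using N[OF that(1)] N[OF that(2)] by argo
      finally have "(hnorm (s m - s n))\<^sup>2 < e\<^sup>2" .
      then show ?thesis
        using e s(1) by (auto simp: hdist_def intro: power2_less_imp_less)
    qed
    then show "\<exists>N. \<forall>n n'. N \<le> n \<longrightarrow> N \<le> n' \<longrightarrow> hdist (s n) (s n') < e" by blast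
  qed (use s in auto)
  then obtain z where z: "limitin mtopology s z sequentially"
    using complete_H by (auto simp: mcomplete_def)
  then have zH: "z \<in> H" by (simp add: limitin_metric)
  have dist0: "(\<lambda>k. hnorm (s k - z)) \<longlonglongrightarrow> 0"
    using z s(1) zH
    by (auto simp: limit_metric_sequentially hdist_def LIMSEQ_def hnorm_nonneg H_closed)
  have "(\<lambda>k. hnorm (s k)) \<longlonglongrightarrow> hnorm z"
  proof (rule LIM_zero_cancel, rule Lim_null_comparison[OF _ dist0], intro always_eventually allI)
    fix k
    show "norm (hnorm (s k) - hnorm z) \<le> hnorm (s k - z)"
      using hnorm_triangle[of "s k - z" z] hnorm_triangle[of "z - s k" "s k"]
        hnorm_minus[of "s k - z"] s(1)[of k] zH
      by (simp add: H_closed abs_le_iff)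
  qed
  moreover have "(\<lambda>k. \<phi> (s k)) \<longlonglongrightarrow> \<phi> z"
  proof (rule LIM_zero_cancel, rule Lim_null_comparison, intro always_eventually allI)
    fix k
    show "norm (\<phi> (s k) - \<phi> z) \<le> C * hnorm (s k - z)"
      using bound[of "s k - z"] add[of "s k - z" z] s(1)[of k] zH by (simp add: H_closed)
    show "(\<lambda>k. C * hnorm (s k - z)) \<longlonglongrightarrow> 0"
      using tendsto_mult[OF tendsto_const dist0, of C] by simp
  qed
  ultimately have "(\<lambda>k. J (s k)) \<longlonglongrightarrow> J z"
    unfolding J_def by (intro tendsto_intros)
  then have Jz: "J z = d" using J_lim LIMSEQ_unique by blast
  have "\<phi> x = ip x z" if x: "x \<in> H" for x
  proof -
    define a where "a = \<phi> x - ip x z"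
    define b where "b = (hnorm x)\<^sup>2"
    have b: "b \<ge> 0" by (simp add: b_def)
    \<comment> \<open>Minimality of \<open>z\<close> is tested along \<open>z + c x\<close>. The
      factor \<open>cnj a\<close> makes \<open>c * a\<close> real and nonnegative, and this
      \<open>t\<close> gives \<open>t * b \<le> 1\<close> even for \<open>b = 0\<close>; the result
      \<open>2 |a|^2 \<le> |a|^2\<close> forces \<open>a = 0\<close>.\<close>
    define t where "t = 1 / (b + 1)"
    define c where "c = complex_of_real t * cnj a"
    have "d \<le> J (z + scale c x)" using x zH by (intro d_le) (simp add: H_closed)
    also have "\<dots> = J z + (cmod c)\<^sup>2 * b + 2 * Re (ip z (scale c x)) - 2 * Re (c * \<phi> x)"
      using x zH
      by (simp add: J_def hnorm_add_square H_closed hnorm_scale add scale b_def power_mult_distrib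
          del: times_complex.sel)
    also have "Re (ip z (scale c x)) = Re (c * ip x z)"
      using x zH ip_commute[of z "scale c x"] by (simp add: H_closed ip_scale_left)
    finally have "2 * Re (c * a) \<le> (cmod c)\<^sup>2 * b"
      by (simp add: Jz a_def algebra_simps)
    moreover have "c * a = complex_of_real (t * (cmod a)\<^sup>2)"
      using complex_norm_square[of a] by (simp add: c_def)
    moreover have "(cmod c)\<^sup>2 = t\<^sup>2 * (cmod a)\<^sup>2"
      by (simp add: c_def norm_mult power_mult_distrib)
    ultimately have "2 * (t * (cmod a)\<^sup>2) \<le> t\<^sup>2 * (cmod a)\<^sup>2 * b"
      by simp
    moreover have "t > 0" using b by (simp add: t_def)
    ultimately have "2 * (cmod a)\<^sup>2 \<le> (t * b) * (cmod a)\<^sup>2"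
      by (simp add: power2_eq_square mult_ac)
    also have "\<dots> \<le> 1 * (cmod a)\<^sup>2"
      using b by (intro mult_right_mono) (simp_all add: t_def)
    finally show ?thesis by (simp add: a_def)
  qed
  with zH show thesis by (rule that)
qed

text \<open>Riesz applies to \<open>x \<mapsto> ip (T x) y\<close>, which Cauchy-Schwarz and
  contractivity bound by \<open>hnorm y * hnorm x\<close>. Uniqueness of the representing vector
  then resolves the \<open>THE\<close> in \<open>adj\<close>.\<close>

lemma adj_contraction:
  assumes T: "contraction T" and y: "y \<in> H"
  shows adj_in: "adj T y \<in> H"
    and ip_adj: "\<And>x. x \<in> H \<Longrightarrow> ip (T x) y = ip x (adj T y)"
proof -
  have TH: "T x \<in> H" if "x \<in> H" for x using T that by (auto simp: contraction_def)
  obtain z where z: "z \<in> H" "\<And>x. x \<in> H \<Longrightarrow> ip (T x) y = ip x z"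
  proof (rule Riesz_representation[of "\<lambda>x. ip (T x) y" "hnorm y"])
    show "cmod (ip (T x) y) \<le> hnorm y * hnorm x" if "x \<in> H" for x
    proof -
      have "hnorm (T x) * hnorm y \<le> hnorm x * hnorm y"
        using T that y by (intro mult_right_mono) (auto simp: contraction_def hnorm_nonneg)
      then show ?thesis
        using Cauchy_Schwarz[OF TH[OF that] y] by (simp add: mult.commute)
    qed
  qed (use T y TH in \<open>auto simp: contraction_def ip_add_left ip_scale_left\<close>)
  then have "\<exists>!z. z \<in> H \<and> (\<forall>x\<in>H. ip (T x) y = ip x z)"
    by (metis eq_if_ip_eq)
  from theI'[OF this]
  show "adj T y \<in> H" "\<And>x. x \<in> H \<Longrightarrow> ip (T x) y = ip x (adj T y)"
    by (auto simp: adj_def)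
qed

text \<open>By Cauchy-Schwarz each \<open>ip m\<close> is continuous, so its zeros survive limits.
  This will remove the closure in \<open>defect_index\<close>.\<close>

lemma closedin_orthogonal_complement:
  assumes "M \<subseteq> H"
  shows "closedin mtopology {x \<in> H. \<forall>m\<in>M. ip m x = 0}"
  unfolding metric_closedin_iff_sequentially_closed
proof (intro conjI allI impI)
  fix s x assume *: "range s \<subseteq> {x \<in> H. \<forall>m\<in>M. ip m x = 0} \<and> limitin mtopology s x sequentially"
  then have s: "s k \<in> H" "\<And>m. m \<in> M \<Longrightarrow> ip m (s k) = 0" for k by auto
  have x: "x \<in> H" using * by (simp add: limitin_metric)
  have dist0: "(\<lambda>k. hnorm (s k - x)) \<longlonglongrightarrow> 0"
    using * s x
    by (auto simp: limit_metric_sequentially hdist_def LIMSEQ_def hnorm_nonneg H_closed)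
  have "ip m x = 0" if m: "m \<in> M" for m
  proof -
    have mH: "m \<in> H" using m assms by auto
    have "cmod (ip m x) \<le> hnorm m * hnorm (s k - x)" for k
      using Cauchy_Schwarz[of m "s k - x"] s(1)[of k] s(2)[OF m, of k] x mH by (simp add: H_closed ip_diff_right)
    moreover have "(\<lambda>k. hnorm m * hnorm (s k - x)) \<longlonglongrightarrow> 0"
      using tendsto_mult[OF tendsto_const dist0, of "hnorm m"] by simp
    ultimately have "cmod (ip m x) \<le> 0"
      by (intro LIMSEQ_le_const) auto
    then show ?thesis by simp
  qed
  with x show "x \<in> {x \<in> H. \<forall>m\<in>M. ip m x = 0}" by blast
qed auto


section \<open>Rank-nullity for possibly infinite dimensions\<close>

lemma edim_eq_card:
  assumes "independent B" "finite B" "B \<subseteq> V" "V \<subseteq> span B"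
  shows "edim V = enat (card B)"
  using assms basis_card_eq_dim[of B V] by (auto simp: edim_def)

lemma edim_finite_basis:
  assumes "edim V \<noteq> \<infinity>"
  obtains B where "independent B" "finite B" "B \<subseteq> V" "V \<subseteq> span B"
proof -
  obtain F where F: "finite F" "V \<subseteq> span F"
    using assms by (auto simp: edim_def split: if_splits)
  obtain B where B: "B \<subseteq> V" "independent B" "V \<subseteq> span B"
    using basis_exists[of V] by metis
  moreover have "finite B"
    using independent_span_bound[of F B] F B by auto
  ultimately show thesis using that by blast
qed

lemma edim_infinite_iff: "edim V = \<infinity> \<longleftrightarrow> (\<nexists>B. finite B \<and> V \<subseteq> span B)"
  by (simp add: edim_def)

text \<open>A basis of the kernel together with lifts of a basis of the image is a basis of
  \<open>V\<close>. Linearity is asked only on \<open>V\<close>, since an adjoint is controlled only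
  on the carrier.\<close>

theorem edim_kernel_plus_image:
  assumes V: "subspace V"
    and add: "\<And>x y. x \<in> V \<Longrightarrow> y \<in> V \<Longrightarrow> f (x + y) = f x + f y"
    and scale: "\<And>c x. x \<in> V \<Longrightarrow> f (scale c x) = scale c (f x)"
  shows "edim V = edim {x \<in> V. f x = 0} + edim (f ` V)"
proof -
  define K where "K = {x \<in> V. f x = 0}"
  have f0: "f 0 = 0" using scale[of 0 0] subspace_0[OF V] by simp
  have f_diff: "f (x - y) = f x - f y" if "x \<in> V" "y \<in> V" for x y
    using add[of "x - y" y] that subspace_diff[OF V] by simp
  \<comment> \<open>For infinite \<open>I\<close> both sums are 0 by convention, and
    \<open>f0\<close> settles that case too.\<close>
  have f_sum: "f (\<Sum>i\<in>I. scale (c i) (h i)) = (\<Sum>i\<in>I. scale (c i) (f (h i)))"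
    if "\<And>i. i \<in> I \<Longrightarrow> h i \<in> V" for I :: "'a set" and c h
    using that
  proof (induction I rule: infinite_finite_induct)
    case (insert i I)
    then have "(\<Sum>i\<in>I. scale (c i) (h i)) \<in> V" "scale (c i) (h i) \<in> V"
      by (auto intro!: subspace_sum subspace_scale V)
    with insert show ?case by (simp add: add scale)
  qed (simp_all add: f0)
  have "edim V = edim K + edim (f ` V)"
  proof (cases "edim K = \<infinity> \<or> edim (f ` V) = \<infinity>")
    case True
    have "edim V = \<infinity>"
    proof (rule ccontr)
      assume "edim V \<noteq> \<infinity>"
      then obtain B where B: "finite B" "B \<subseteq> V" "V \<subseteq> span B"
        by (rule edim_finite_basis)
      have "K \<subseteq> span B" using B by (auto simp: K_def)
      moreover have "f ` V \<subseteq> span (f ` B)"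
      proof
        fix w assume "w \<in> f ` V"
        then obtain v where v: "v \<in> V" "w = f v" by blast
        then have "v \<in> span B" using B by blast
        then obtain c where "v = (\<Sum>b\<in>B. scale (c b) b)"
          using span_finite[OF B(1)] by auto
        then have "w = (\<Sum>b\<in>B. scale (c b) (f b))"
          using v f_sum[of B "\<lambda>b. b" c] B by auto
        then show "w \<in> span (f ` B)"
          by (auto intro: span_sum span_scale span_base)
      qed
      ultimately show False
        using True B(1) by (auto simp: edim_infinite_iff)
    qed
    with True show ?thesis by auto
  next
    case False
    then obtain B where B: "independent B" "finite B" "B \<subseteq> K" "K \<subseteq> span B"
      using edim_finite_basis by metis
    obtain C where C: "independent C" "finite C" "C \<subseteq> f ` V" "f ` V \<subseteq> span C"
      using False edim_finite_basis by metis
    have "\<forall>c\<in>C. \<exists>v\<in>V. f v = c" using C(3) by (auto simp: image_iff)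
    then obtain g where g: "\<And>c. c \<in> C \<Longrightarrow> g c \<in> V" "\<And>c. c \<in> C \<Longrightarrow> f (g c) = c"
      by metis
    have inj: "inj_on g C" by (metis g(2) inj_onI)
    have BV: "\<And>b. b \<in> B \<Longrightarrow> b \<in> V" and Bf: "\<And>b. b \<in> B \<Longrightarrow> f b = 0"
      using B(3) by (auto simp: K_def)
    \<comment> \<open>\<open>f\<close> vanishes on \<open>B\<close> but sends \<open>g c\<close> to
      \<open>c\<close>, which is nonzero; hence the two parts of the new basis are disjoint.\<close>
    have C0: "0 \<notin> C" using C(1) dependent_zero by blast
    have disj: "B \<inter> g ` C = {}"
      using Bf g(2) C0 by fastforce
    have ind: "independent (B \<union> g ` C)"
    proof (rule independent_if_scalars_zero)
      fix u x assume u: "(\<Sum>x\<in>B \<union> g ` C. scale (u x) x) = 0" and x: "x \<in> B \<union> g ` C"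
      have sum: "(\<Sum>x\<in>B. scale (u x) x) + (\<Sum>c\<in>C. scale (u (g c)) (g c)) = 0"
        using u B(2) C(2) disj by (simp add: sum.union_disjoint sum.reindex[OF inj])
      \<comment> \<open>Applying \<open>f\<close> kills the kernel part and leaves a linear relation
        on \<open>C\<close>; once its coefficients vanish, only a relation on \<open>B\<close>
        remains.\<close>
      have "f ((\<Sum>x\<in>B. scale (u x) x) + (\<Sum>c\<in>C. scale (u (g c)) (g c)))
          = (\<Sum>x\<in>B. scale (u x) (f x)) + (\<Sum>c\<in>C. scale (u (g c)) (f (g c)))"
        using BV g(1)
        by (subst add)
           (auto intro!: subspace_sum subspace_scale V simp: f_sum f_sum[of B "\<lambda>b. b"])
      then have "(\<Sum>c\<in>C. scale (u (g c)) c) = 0"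
        using sum Bf g(2) f0 by simp
      then have uC: "u (g c) = 0" if "c \<in> C" for c
        using independentD[OF C(1,2) order.refl, of "\<lambda>c. u (g c)"] that by blast
      with sum have "(\<Sum>x\<in>B. scale (u x) x) = 0" by simp
      then have "u b = 0" if "b \<in> B" for b
        using independentD[OF B(1,2) order.refl, of u] that by blast
      with uC x show "u x = 0" by blast
    qed (use B(2) C(2) in simp)
    have "V \<subseteq> span (B \<union> g ` C)"
    proof
      fix v assume v: "v \<in> V"
      then have "f v \<in> span C" using C by blast
      then obtain c where c: "f v = (\<Sum>b\<in>C. scale (c b) b)"
        using span_finite[OF C(2)] by auto
      define w where "w = (\<Sum>b\<in>C. scale (c b) (g b))"
      have w: "w \<in> V" unfolding w_def using g(1) by (intro subspace_sum subspace_scale V)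
      have "f w = f v" using g by (simp add: w_def f_sum c)
      then have "v - w \<in> K" using v w by (simp add: K_def f_diff subspace_diff[OF V])
      then have "v - w \<in> span (B \<union> g ` C)"
        using B(4) span_mono[of B "B \<union> g ` C"] by blast
      moreover have "w \<in> span (B \<union> g ` C)"
        unfolding w_def by (intro span_sum span_scale span_base) auto
      ultimately show "v \<in> span (B \<union> g ` C)"
        using span_add by fastforce
    qed
    then have "edim V = enat (card (B \<union> g ` C))"
      using ind B C g BV by (intro edim_eq_card) auto
    also have "\<dots> = enat (card B) + enat (card C)"
      using B C disj by (simp add: card_Un_disjoint card_image[OF inj])
    also have "\<dots> = edim K + edim (f ` V)"
      using edim_eq_card B C by simp
    finally show ?thesis .
  qed
  then show ?thesis by (simp add: K_def)
qed

end


section \<open>Isometries are maximal contractions\<close>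

text \<open>All conditions on \<open>T\<close> concern \<open>H\<close> alone, so that
  \<open>restrict Mz S\<close>, which is \<open>undefined\<close> outside \<open>S\<close>,
  qualifies.\<close>

locale hilbert_isometry = complex_hilbert_space +
  fixes T :: "'a \<Rightarrow> 'a"
  assumes T_in: "x \<in> H \<Longrightarrow> T x \<in> H"
    and T_add: "x \<in> H \<Longrightarrow> y \<in> H \<Longrightarrow> T (x + y) = T x + T y"
    and T_scale: "x \<in> H \<Longrightarrow> T (scale c x) = scale c (T x)"
    and T_ip: "x \<in> H \<Longrightarrow> y \<in> H \<Longrightarrow> ip (T x) (T y) = ip x y"
begin

lemma contraction_T: "contraction T"
  using T_in T_add T_scale T_ip by (auto simp: contraction_def hnorm_def)

abbreviation A :: "'a \<Rightarrow> 'a" where "A \<equiv> adj T"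

lemmas A_in = adj_in[OF contraction_T]
lemmas ip_A = ip_adj[OF contraction_T]

text \<open>Both sides have the same inner product with every \<open>y\<close> in \<open>H\<close>,
  namely \<open>ip (T y) (T x) = ip y x\<close>.\<close>

lemma A_T: "x \<in> H \<Longrightarrow> A (T x) = x"
  using ip_A[of "T x"] T_ip by (intro eq_if_ip_eq) (auto simp: A_in T_in)

lemma A_add: "x \<in> H \<Longrightarrow> y \<in> H \<Longrightarrow> A (x + y) = A x + A y"
  by (intro eq_if_ip_eq) (auto simp: A_in H_closed ip_add_right T_in simp flip: ip_A)

lemma A_scale: "x \<in> H \<Longrightarrow> A (scale c x) = scale c (A x)"
  by (intro eq_if_ip_eq) (auto simp: A_in H_closed ip_scale_right T_in simp flip: ip_A)

section \<open>Powers of the isometry and of its adjoint\<close>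

lemma T_pow_in: "x \<in> H \<Longrightarrow> (T ^^ n) x \<in> H"
  by (induction n) (auto simp: T_in)

lemma A_pow_in: "x \<in> H \<Longrightarrow> (A ^^ n) x \<in> H"
  by (induction n) (auto simp: A_in)

lemma T_pow_0: "(T ^^ n) 0 = 0"
  using T_scale[of 0 0] by (induction n) (auto simp: H_closed)

lemma A_pow_add: "x \<in> H \<Longrightarrow> y \<in> H \<Longrightarrow> (A ^^ n) (x + y) = (A ^^ n) x + (A ^^ n) y"
  by (induction n) (auto simp: A_add A_pow_in)

lemma A_pow_scale: "x \<in> H \<Longrightarrow> (A ^^ n) (scale c x) = scale c ((A ^^ n) x)"
  by (induction n) (auto simp: A_scale A_pow_in)

lemma A_pow_diff: "x \<in> H \<Longrightarrow> y \<in> H \<Longrightarrow> (A ^^ n) (x - y) = (A ^^ n) x - (A ^^ n) y"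
  using A_pow_add[of "x - y" y n] by (simp add: H_closed)

text \<open>The innermost pair \<open>A (T _)\<close> cancels, which lowers both exponents by
  one.\<close>

lemma A_pow_T_pow: "x \<in> H \<Longrightarrow> (A ^^ n) ((T ^^ n) x) = x"
proof (induction n)
  case (Suc n)
  have "(A ^^ Suc n) ((T ^^ Suc n) x) = (A ^^ n) (A (T ((T ^^ n) x)))"
    by (simp add: funpow_swap1)
  with Suc show ?case by (simp add: A_T T_pow_in)
qed simp

lemma ip_A_pow: "x \<in> H \<Longrightarrow> y \<in> H \<Longrightarrow> ip ((T ^^ n) x) y = ip x ((A ^^ n) y)"
proof (induction n arbitrary: y)
  case (Suc n)
  then show ?case by (simp add: ip_A T_pow_in A_in funpow_swap1[of A])
qed simp

section \<open>Kernels of the adjoint powers and their dimensions\<close>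

definition W :: "nat \<Rightarrow> 'a set" where
  "W n = {x \<in> H. (A ^^ n) x = 0}"

lemma subspace_W: "subspace (W n)"
  using A_pow_scale[of 0 n 0]
  by (auto simp: W_def A_pow_add A_pow_scale H_closed intro!: subspaceI)

text \<open>\<open>A^n T^n = I\<close> makes \<open>A^n\<close> annihilate the range; conversely the
  operator fixes every vector of the kernel.\<close>

lemma range_defect_operator: "(\<lambda>x. x - (T ^^ n) ((A ^^ n) x)) ` H = W n"
proof (intro equalityI subsetI)
  fix x assume "x \<in> (\<lambda>x. x - (T ^^ n) ((A ^^ n) x)) ` H"
  then show "x \<in> W n"
    by (auto simp: W_def A_pow_diff A_pow_T_pow A_pow_in T_pow_in H_closed)
next
  fix x assume "x \<in> W n"
  then have "x \<in> H" "x = x - (T ^^ n) ((A ^^ n) x)"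
    by (auto simp: W_def T_pow_0)
  then show "x \<in> (\<lambda>x. x - (T ^^ n) ((A ^^ n) x)) ` H" by (rule rev_image_eqI)
qed

text \<open>The kernel of an adjoint is the orthogonal complement of the range. In this form
  \<open>W n\<close> is visibly closed.\<close>

lemma W_eq_orthogonal_complement: "W n = {x \<in> H. \<forall>m \<in> (T ^^ n) ` H. ip m x = 0}"
proof -
  have "(A ^^ n) x = 0 \<longleftrightarrow> (\<forall>h\<in>H. ip ((T ^^ n) h) x = 0)" if "x \<in> H" for x
    using that eq_if_ip_eq[of "(A ^^ n) x" 0]
    by (auto simp: ip_A_pow A_pow_in H_closed ip_zero_right)
  then show ?thesis by (auto simp: W_def)
qed

lemma defect_index_eq: "defect_index T n = edim (W n)"
proof -
  have "closedin mtopology (W n)"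
    unfolding W_eq_orthogonal_complement
    by (intro closedin_orthogonal_complement) (auto simp: T_pow_in)
  then show ?thesis
    by (simp add: defect_index_def range_defect_operator closure_of_closedin)
qed

lemma edim_W_Suc: "edim (W (Suc n)) = edim (W 1) + edim (W n)"
proof -
  have "edim (W (Suc n)) = edim {x \<in> W (Suc n). A x = 0} + edim (A ` W (Suc n))"
    by (intro edim_kernel_plus_image subspace_W) (auto simp: W_def A_add A_scale)
  also have "{x \<in> W (Suc n). A x = 0} = W 1"
  \<comment> \<open>\<open>A^n 0 = 0\<close> is what places \<open>W 1\<close> inside
    \<open>W (Suc n)\<close>.\<close>
  proof -
    have "(A ^^ n) 0 = 0" using A_pow_scale[of 0 n 0] by (simp add: H_closed)
    then show ?thesis by (auto simp: W_def funpow_swap1)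
  qed
  also have "A ` W (Suc n) = W n"
  proof (intro equalityI subsetI)
    fix x assume "x \<in> A ` W (Suc n)"
    then show "x \<in> W n" by (auto simp: W_def A_in funpow_swap1)
  next
    fix x assume "x \<in> W n"
    \<comment> \<open>The isometry supplies the preimage: \<open>A (T x) = x\<close>, and
      \<open>A^(n+1) (T x) = A^n x = 0\<close>.\<close>
    then have "x = A (T x)" "T x \<in> W (Suc n)"
      by (auto simp: W_def A_T T_in funpow_swap1)
    then show "x \<in> A ` W (Suc n)" by (rule image_eqI)
  qed
  finally show ?thesis .
qed

lemma edim_W: "edim (W n) = enat n * edim (W 1)"
proof (induction n)
  case 0
  \<comment> \<open>Starting at 0 is sound even for infinite \<open>edim (W 1)\<close>, because
    \<open>0 * \<infinity> = 0\<close> in \<open>enat\<close>.\<close>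
  have "W 0 = {0}" by (auto simp: W_def H_closed)
  then have "edim (W 0) = 0"
    using edim_eq_card[of "{}" "W 0"]
    by (simp add: zero_enat_def independent_empty)
  then show ?case by (simp flip: zero_enat_def)
next
  case (Suc n)
  have "enat (Suc n) = 1 + enat n" by (simp add: one_enat_def)
  with Suc show ?case by (simp only: edim_W_Suc distrib_right mult_1_left)
qed

theorem maximal_contraction_T: "maximal_contraction T"
  unfolding maximal_contraction_def defect_index_eq
  using contraction_T edim_W by blast

end


section \<open>Multiplication by the coordinate\<close>

lemma fps_expansion_Mz:
  assumes "f \<in> hardy2"
  shows "fps_expansion (Mz f) 0 = fps_X * fps_expansion f 0"
  using has_fps_expansion_mult[OF has_fps_expansion_fps_X hardy2_has_fps_expansion[OF assms]]
  by (intro fps_expansion_eqI) (simp add: Mz_def)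

text \<open>\<open>Mz\<close> shifts Taylor coefficients by one place and puts 0 in front, so the
  series loses only a vanishing head term.\<close>

lemma hardy_ip_Mz:
  assumes f: "f \<in> hardy2" and g: "g \<in> hardy2"
  shows "hardy_ip (Mz f) (Mz g) = hardy_ip f g"
proof -
  let ?a = "\<lambda>n. taylor_coeff (Mz f) n * cnj (taylor_coeff (Mz g) n)"
  have "(\<lambda>n. ?a (Suc n)) = (\<lambda>n. taylor_coeff f n * cnj (taylor_coeff g n))"
    using f g by (simp add: fps_expansion_Mz)
  \<comment> \<open>Splitting off the head of the series requires summability, which is inherited
    from the shifted series.\<close>
  moreover from this have "summable ?a"
    using hardy_ip_summable[OF f g] summable_Suc_iff[of ?a] by simp
  ultimately show ?thesis
    using f g suminf_split_head[of ?a] by (simp add: hardy_ip_def fps_expansion_Mz)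
qed

theorem theorem4p1:
  fixes S :: "(complex \<Rightarrow> complex) set"
  assumes "hardy_submodule S"
  shows "maximal_submodule S"
proof -
  interpret S: complex_hilbert_space fscale S hardy_ip
    using assms by (rule hardy_submodule_hilbert_space)
  \<comment> \<open>Closed sets of the metric topology lie in its carrier, so the isometry identity
    on \<open>hardy2\<close> holds on \<open>S\<close>.\<close>
  have SH: "S \<subseteq> hardy2"
    using assms hardy.metric_closedin_iff_sequentially_closed by (auto simp: hardy_submodule_def)
  interpret hilbert_isometry fscale S hardy_ip "restrict Mz S"
  proof
    show "restrict Mz S x \<in> S" if "x \<in> S" for x
      using that assms by (auto simp: hardy_submodule_def)
    show "restrict Mz S (x + y) = restrict Mz S x + restrict Mz S y" if "x \<in> S" "y \<in> S" for x y
      using that by (auto simp: S.H_closed Mz_def algebra_simps)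
    show "restrict Mz S (fscale c x) = fscale c (restrict Mz S x)" if "x \<in> S" for c x
      using that by (auto simp: S.H_closed Mz_def)
    show "hardy_ip (restrict Mz S x) (restrict Mz S y) = hardy_ip x y" if "x \<in> S" "y \<in> S" for x y
      using that SH by (auto intro!: hardy_ip_Mz)
  qed
  show ?thesis
    using maximal_contraction_T by (simp add: maximal_submodule_def)
qed

end
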